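(* Let $M$ be an indecomposable $\mathbb{F}_1$-representation of a quiver $Q$, and let $c:\Gamma\to Q$ be the associated winding, with basepoint $b\in\Gamma_0$. Let $\underline{\partial}=(\partial_i)_{i=0}^{\infty}$ be a nice sequence for $M$. Then for each $i\ge 0$ there exists a unique affine map $$\operatorname{ev}^{(i)}(\underline{\partial}):\mathcal{V}^{(i)}_M\to\mathbb{Z}$$ such that $\partial_i=\operatorname{ev}^{(i)}(\underline{\partial})\circ X^{(i)}$, where $X^{(i)}:\Gamma_0\to\mathcal{V}^{(i)}_M$ is the universal $i$-nice grading of $M$ with respect to $b$.
   Context: Quivers $Q=(Q_0,Q_1,s,t)$ are finite; loops and multiple arrows are allowed. An $\mathbb{F}_1$-vector space is a finite pointed set; an $\mathbb{F}_1$-linear map is a pointed function injective on the complement of the preimage of $0$. An $\mathbb{F}_1$-representation $M$ of $Q$ consists of $\mathbb{F}_1$-vector spaces $M_v$ ($v\in Q_0$) and $\mathbb{F}_1$-linear maps $M_\alpha:M_{s(\alpha)}\to M_{t(\alpha)}$ ($\alpha\in Q_1$). Direct sums are obtained by gluing pointed sets at $0$; $M$ is indecomposable if it is not a nontrivial direct sum of subrepresentations. A winding is a quiver map $c:\Gamma\to Q$ such that distinct arrows of $\Gamma$ with the same source, or with the same target, have distinct images in $Q_1$. The winding $c_M:\Gamma_M\to Q$ associated to $M$ has as vertices of $\Gamma_M$ the nonzero elements of all the $M_v$ (elements of $M_v$ being sent to $v$), with one arrow $x\to y$ sent to $\alpha$ whenever $M_\alpha(x)=y\ne 0$. Every winding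 arises in this way from an $\mathbb{F}_1$-representation, unique up to isomorphism; $M$ is indecomposable exactly when $\Gamma_M$ is connected, and then the winding is called indecomposable. Gradings. A grading of $M$ is a map $\partial:\Gamma_0\to\mathbb{Z}$. It is a nice grading if $c(\beta)=c(\beta')$ implies $\partial(t(\beta))-\partial(s(\beta))=\partial(t(\beta'))-\partial(s(\beta'))$ for all $\beta,\beta'\in\Gamma_1$. It is a $(\partial_0,\dots,\partial_{i-1})$-nice grading if the same equality holds for all $\beta,\beta'\in\Gamma_1$ with $c(\beta)=c(\beta')$, $\partial_j(s(\beta))=\partial_j(s(\beta'))$ and $\partial_j(t(\beta))=\partial_j(t(\beta'))$ for $j=0,\dots,i-1$. A nice sequence is a sequence $(\partial_i)_{i\ge0}$ of gradings such that $\partial_0$ is nice and $\partial_i$ is $(\partial_0,\dots,\partial_{i-1})$-nice for every $i>0$. Homology. $H_1(Q,\mathbb{Z})$ is the kernel of $\mathbb{Z}Q_1\to\mathbb{Z}Q_0$, $\alpha\mapsto t(\alpha)-s(\alpha)$; $\iota:H_1(Q,\mathbb{Z})\to\mathbb{Z}Q_1$ is the inclusion, and $H_1(c):H_1(\Gamma,\mathbb{Z})\to H_1(Q,\mathbb{Z})$ is induced by $\alpha\mapsto c(\alpha)$. Universal nice grading. For an indecomposable winding $c:\Gamma\to Q$ with associated representation $M$ and basepoint $b\in\Gamma_0$, let $G=\mathbb{Z}Q_1/\operatorname{Im}(\iota\circ H_1(c))$ and $\mathcal{V}_M=G/t(G)$ with $t(G)$ the torsion subgroup. Define $X(M):\Gamma_0\to\mathcal{V}_M$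 by $X(M)_b=0$ and, for $v\ne b$, $X(M)_v=$ the class of $\sum_j\epsilon_jc(\alpha_j)$ for any walk $\alpha_1^{\epsilon_1}\cdots\alpha_d^{\epsilon_d}$ ($\epsilon_j=\pm1$, with $\epsilon_j=+1$ if $\alpha_j$ is traversed from source to target and $-1$ otherwise) in $\Gamma$ from $b$ to $v$; this is independent of the walk. Iteration. Given an indecomposable winding $c:\Gamma\to Q$ with associated $\mathbb{F}_1$-representation $M$ of $Q$, a basepoint $b\in\Gamma_0$, and the universal nice grading $X=X(M):\Gamma_0\to\mathcal{V}_M$ of $M$ with respect to $b$, define a quiver $Q^+$ with vertices $\{(X_v,c(v)):v\in\Gamma_0\}$ and arrows $\{\alpha^+:=(X_{s(\alpha)},X_{t(\alpha)},c(\alpha)):\alpha\in\Gamma_1\}$, with $s(\alpha^+)=(X_{s(\alpha)},c(s(\alpha)))$ and $t(\alpha^+)=(X_{t(\alpha)},c(t(\alpha)))$. The map $c^+:\Gamma\to Q^+$, $\alpha\mapsto\alpha^+$, is again an indecomposable winding. Starting from $\sigma^{(0)}=c$, $Q^{(0)}=Q$, $M^{(0)}=M$, put $Q^{(i+1)}=(Q^{(i)})^+$, $\sigma^{(i+1)}=(\sigma^{(i)})^+:\Gamma\to Q^{(i+1)}$, and let $M^{(i+1)}$ be the representation of $Q^{(i+1)}$ corresponding to $\sigma^{(i+1)}$, always using the same basepoint $b$. Set $\mathcal{V}^{(i)}_M=\mathcal{V}_{M^{(i)}}$ and $X^{(i)}=X(M^{(i)}):\Gamma_0\to\mathcal{V}^{(i)}_M$,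 the universal $i$-nice grading of $M$. A function $f:A\to B$ of abelian groups is affine if $x\mapsto f(x)-z$ is a group homomorphism for some $z\in B$.
   Formalization: For i = 0, uniqueness of the affine map is asserted only when the winding c is surjective on arrows of Q; it fails whenever an arrow of Q is not in the image of c. Existence for all i, and uniqueness for all i ≥ 1, are as stated. *)

theory Defs
  imports "HOL-Algebra.Algebra" "Graph_Theory.Digraph"
begin

text \<open>
  Quivers are the multi-digraphs \<open>pre_digraph\<close> of Graph\_Theory: arcs are named, and parallel
  arcs and loops are allowed. A finite quiver is a \<open>fin_digraph\<close>.
\<close>

section \<open>Representations over the field with one element\<close>

record ('v, 'e, 'm) f1_rep =
  pts :: "'v \<Rightarrow> 'm set"
  base :: "'v \<Rightarrow> 'm"
  act :: "'e \<Rightarrow> 'm \<Rightarrow> 'm"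

definition f1_space :: "'m set \<Rightarrow> 'm \<Rightarrow> bool" where
  "f1_space A z \<longleftrightarrow> finite A \<and> z \<in> A"

definition f1_linear :: "'m set \<Rightarrow> 'm \<Rightarrow> 'n set \<Rightarrow> 'n \<Rightarrow> ('m \<Rightarrow> 'n) \<Rightarrow> bool" where
  "f1_linear A z B y f \<longleftrightarrow> f \<in> A \<rightarrow> B \<and> f z = y \<and> inj_on f {x \<in> A. f x \<noteq> y}"

definition f1_representation :: "('v, 'e) pre_digraph \<Rightarrow> ('v, 'e, 'm) f1_rep \<Rightarrow> bool" where
  "f1_representation Q M \<longleftrightarrow>
     (\<forall>v \<in> verts Q. f1_space (pts M v) (base M v)) \<and>
     (\<forall>\<alpha> \<in> arcs Q. f1_linear (pts M (tail Q \<alpha>)) (base M (tail Q \<alpha>))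
                              (pts M (head Q \<alpha>)) (base M (head Q \<alpha>)) (act M \<alpha>))"

definition subrep :: "('v, 'e) pre_digraph \<Rightarrow> ('v, 'e, 'm) f1_rep \<Rightarrow> ('v \<Rightarrow> 'm set) \<Rightarrow> bool" where
  "subrep Q M N \<longleftrightarrow>
     (\<forall>v \<in> verts Q. N v \<subseteq> pts M v \<and> base M v \<in> N v) \<and>
     (\<forall>\<alpha> \<in> arcs Q. act M \<alpha> ` N (tail Q \<alpha>) \<subseteq> N (head Q \<alpha>))"

definition nonzero_subrep :: "('v, 'e) pre_digraph \<Rightarrow> ('v, 'e, 'm) f1_rep \<Rightarrow> ('v \<Rightarrow> 'm set) \<Rightarrow> bool" where
  "nonzero_subrep Q M N \<longleftrightarrow> (\<exists>v \<in> verts Q. N v \<noteq> {base M v})"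

text \<open>
  The direct sum of pointed sets glues them at the base point; hence \<open>M\<close> is the direct sum of
  its subrepresentations \<open>N\<close> and \<open>N'\<close> when at each vertex they cover \<open>M\<close> and meet in the base
  point only.
\<close>

definition internal_sum ::
    "('v, 'e) pre_digraph \<Rightarrow> ('v, 'e, 'm) f1_rep \<Rightarrow> ('v \<Rightarrow> 'm set) \<Rightarrow> ('v \<Rightarrow> 'm set) \<Rightarrow> bool" where
  "internal_sum Q M N N' \<longleftrightarrow>
     (\<forall>v \<in> verts Q. N v \<union> N' v = pts M v \<and> N v \<inter> N' v = {base M v})"

definition indecomposable :: "('v, 'e) pre_digraph \<Rightarrow> ('v, 'e, 'm) f1_rep \<Rightarrow> bool" where
  "indecomposable Q M \<longleftrightarrow>
     \<not> (\<exists>N N'. subrep Q M N \<and> subrep Q M N' \<and> internal_sum Q M N N' \<and>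
               nonzero_subrep Q M N \<and> nonzero_subrep Q M N')"


section \<open>Quiver maps and the winding of a representation\<close>

record ('w, 'a, 'v, 'e) quiver_map =
  src :: "('w, 'a) pre_digraph"
  tgt :: "('v, 'e) pre_digraph"
  vmap :: "'w \<Rightarrow> 'v"
  amap :: "'a \<Rightarrow> 'e"

text \<open>
  The sets \<open>M\<^sub>v\<close> share a type, so the vertices of the coefficient quiver are pairs of \<open>v\<close> and a
  nonzero element of \<open>M\<^sub>v\<close>. An arrow over \<open>\<alpha>\<close> is determined by its source \<open>x\<close> and is named
  \<open>(\<alpha>, x)\<close>.
\<close>

definition coeff_quiver ::
    "('v, 'e) pre_digraph \<Rightarrow> ('v, 'e, 'm) f1_rep \<Rightarrow> ('v \<times> 'm, 'e \<times> 'm) pre_digraph" where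
  "coeff_quiver Q M = \<lparr>
     verts = {(v, x). v \<in> verts Q \<and> x \<in> pts M v \<and> x \<noteq> base M v},
     arcs = {(\<alpha>, x). \<alpha> \<in> arcs Q \<and> x \<in> pts M (tail Q \<alpha>) \<and> x \<noteq> base M (tail Q \<alpha>) \<and>
                     act M \<alpha> x \<noteq> base M (head Q \<alpha>)},
     tail = (\<lambda>(\<alpha>, x). (tail Q \<alpha>, x)),
     head = (\<lambda>(\<alpha>, x). (head Q \<alpha>, act M \<alpha> x)) \<rparr>"

definition assoc_winding ::
    "('v, 'e) pre_digraph \<Rightarrow> ('v, 'e, 'm) f1_rep \<Rightarrow> ('v \<times> 'm, 'e \<times> 'm, 'v, 'e) quiver_map" where
  "assoc_winding Q M = \<lparr> src = coeff_quiver Q M, tgt = Q, vmap = fst, amap = fst \<rparr>"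


section \<open>Nice sequences of gradings\<close>

definition nice_grading :: "('w, 'a, 'v, 'e) quiver_map \<Rightarrow> ('w \<Rightarrow> int) \<Rightarrow> bool" where
  "nice_grading c d \<longleftrightarrow>
     (\<forall>\<beta> \<in> arcs (src c). \<forall>\<beta>' \<in> arcs (src c). amap c \<beta> = amap c \<beta>' \<longrightarrow>
        d (head (src c) \<beta>) - d (tail (src c) \<beta>) = d (head (src c) \<beta>') - d (tail (src c) \<beta>'))"

definition nice_grading_wrt ::
    "('w, 'a, 'v, 'e) quiver_map \<Rightarrow> (nat \<Rightarrow> 'w \<Rightarrow> int) \<Rightarrow> nat \<Rightarrow> ('w \<Rightarrow> int) \<Rightarrow> bool" where
  "nice_grading_wrt c ds i d \<longleftrightarrow>
     (\<forall>\<beta> \<in> arcs (src c). \<forall>\<beta>' \<in> arcs (src c).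
        amap c \<beta> = amap c \<beta>' \<and>
        (\<forall>j < i. ds j (tail (src c) \<beta>) = ds j (tail (src c) \<beta>') \<and>
                 ds j (head (src c) \<beta>) = ds j (head (src c) \<beta>')) \<longrightarrow>
        d (head (src c) \<beta>) - d (tail (src c) \<beta>) = d (head (src c) \<beta>') - d (tail (src c) \<beta>'))"

definition nice_sequence :: "('w, 'a, 'v, 'e) quiver_map \<Rightarrow> (nat \<Rightarrow> 'w \<Rightarrow> int) \<Rightarrow> bool" where
  "nice_sequence c ds \<longleftrightarrow> nice_grading c (ds 0) \<and> (\<forall>i > 0. nice_grading_wrt c ds i (ds i))"


section \<open>Homology\<close>

definition H1 :: "('v, 'e) pre_digraph \<Rightarrow> ('e \<Rightarrow>\<^sub>0 int) set" where
  "H1 Q = kernel (free_Abelian_group (arcs Q)) (free_Abelian_group (verts Q))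
            (frag_extend (\<lambda>\<alpha>. frag_of (head Q \<alpha>) - frag_of (tail Q \<alpha>)))"

definition H1_image :: "('w, 'a, 'v, 'e) quiver_map \<Rightarrow> ('e \<Rightarrow>\<^sub>0 int) set" where
  "H1_image c = frag_extend (\<lambda>\<alpha>. frag_of (amap c \<alpha>)) ` H1 (src c)"

definition torsion_part :: "('g, 'x) monoid_scheme \<Rightarrow> 'g set" where
  "torsion_part G = {x \<in> carrier G. \<exists>n::nat. n > 0 \<and> x [^]\<^bsub>G\<^esub> n = \<one>\<^bsub>G\<^esub>}"

definition homology_quot :: "('w, 'a, 'v, 'e) quiver_map \<Rightarrow> ('e \<Rightarrow>\<^sub>0 int) set monoid" where
  "homology_quot c = free_Abelian_group (arcs (tgt c)) Mod H1_image c"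

definition grading_group :: "('w, 'a, 'v, 'e) quiver_map \<Rightarrow> ('e \<Rightarrow>\<^sub>0 int) set set monoid" where
  "grading_group c = homology_quot c Mod torsion_part (homology_quot c)"

definition grading_class ::
    "('w, 'a, 'v, 'e) quiver_map \<Rightarrow> ('e \<Rightarrow>\<^sub>0 int) \<Rightarrow> ('e \<Rightarrow>\<^sub>0 int) set set" where
  "grading_class c x =
     torsion_part (homology_quot c) #>\<^bsub>homology_quot c\<^esub>
       (H1_image c #>\<^bsub>free_Abelian_group (arcs (tgt c))\<^esub> x)"


section \<open>The universal nice grading\<close>

text \<open>A step \<open>(\<alpha>, True)\<close> traverses \<open>\<alpha>\<close> from source to target, \<open>(\<alpha>, False)\<close> backwards.\<close>

fun walk :: "('w, 'a) pre_digraph \<Rightarrow> 'w \<Rightarrow> ('a \<times> bool) list \<Rightarrow> 'w \<Rightarrow> bool" where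
  "walk \<Gamma> u [] v \<longleftrightarrow> u \<in> verts \<Gamma> \<and> u = v"
| "walk \<Gamma> u ((\<alpha>, fwd) # p) v \<longleftrightarrow>
     \<alpha> \<in> arcs \<Gamma> \<and>
     (if fwd then tail \<Gamma> \<alpha> = u \<and> walk \<Gamma> (head \<Gamma> \<alpha>) p v
      else head \<Gamma> \<alpha> = u \<and> walk \<Gamma> (tail \<Gamma> \<alpha>) p v)"

definition walk_sum :: "('w, 'a, 'v, 'e) quiver_map \<Rightarrow> ('a \<times> bool) list \<Rightarrow> 'e \<Rightarrow>\<^sub>0 int" where
  "walk_sum c p =
     sum_list (map (\<lambda>(\<alpha>, fwd). if fwd then frag_of (amap c \<alpha>) else - frag_of (amap c \<alpha>)) p)"

definition universal_grading ::
    "('w, 'a, 'v, 'e) quiver_map \<Rightarrow> 'w \<Rightarrow> 'w \<Rightarrow> ('e \<Rightarrow>\<^sub>0 int) set set" where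
  "universal_grading c b v =
     (if v = b then \<one>\<^bsub>grading_group c\<^esub>
      else THE x. \<exists>p. walk (src c) b p v \<and> x = grading_class c (walk_sum c p))"


section \<open>Iteration\<close>

text \<open>
  In the iteration \<open>Q, Q\<^sup>+, Q\<^sup>+\<^sup>+, \<dots>\<close> the vertices and arrows are nested pairs and triples involving
  elements of ever new grading groups, so their literal types would grow with every step. To have
  one type for all stages, an element \<open>X\<^sub>v\<close> of the grading group is recorded, inside vertices and
  arrows, by the fibre \<open>{w. X\<^sub>w = X\<^sub>v}\<close> in the vertex set of \<open>\<Gamma>\<close>. This encoding is injective on
  the values of \<open>X\<close>, and no other elements of the grading group occur in \<open>Q\<^sup>+\<close>.
  The constructors \<open>BaseV\<close>, \<open>BaseA\<close> embed the given quiver; \<open>PlusV\<close> and \<open>PlusA\<close> are the pairs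
  and triples.
\<close>

datatype ('w, 'v) plus_vert = BaseV 'v | PlusV "'w set" "('w, 'v) plus_vert"
datatype ('w, 'e) plus_arc = BaseA 'e | PlusA "'w set" "'w set" "('w, 'e) plus_arc"

definition grading_fibre :: "('w, 'a, 'v, 'e) quiver_map \<Rightarrow> 'w \<Rightarrow> 'w \<Rightarrow> 'w set" where
  "grading_fibre c b v =
     {w \<in> verts (src c). universal_grading c b w = universal_grading c b v}"

definition plus_vmap ::
    "('w, 'a, ('w, 'v) plus_vert, ('w, 'e) plus_arc) quiver_map \<Rightarrow> 'w \<Rightarrow> 'w \<Rightarrow> ('w, 'v) plus_vert" where
  "plus_vmap c b v = PlusV (grading_fibre c b v) (vmap c v)"

definition plus_amap ::
    "('w, 'a, ('w, 'v) plus_vert, ('w, 'e) plus_arc) quiver_map \<Rightarrow> 'w \<Rightarrow> 'a \<Rightarrow> ('w, 'e) plus_arc" where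
  "plus_amap c b \<alpha> =
     PlusA (grading_fibre c b (tail (src c) \<alpha>)) (grading_fibre c b (head (src c) \<alpha>)) (amap c \<alpha>)"

text \<open>
  Since \<open>c (s \<alpha>)\<close> is the source of \<open>c \<alpha>\<close> in \<open>Q\<close>, the prescribed source \<open>(X\<^bsub>s \<alpha>\<^esub>, c (s \<alpha>))\<close> of
  \<open>\<alpha>\<^sup>+\<close> can be read off from \<open>\<alpha>\<^sup>+\<close> itself; likewise the target. Base arrows never occur in \<open>Q\<^sup>+\<close>.
\<close>

definition plus_quiver ::
    "('w, 'a, ('w, 'v) plus_vert, ('w, 'e) plus_arc) quiver_map \<Rightarrow> 'w \<Rightarrow>
     (('w, 'v) plus_vert, ('w, 'e) plus_arc) pre_digraph" where
  "plus_quiver c b = \<lparr>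
     verts = plus_vmap c b ` verts (src c),
     arcs = plus_amap c b ` arcs (src c),
     tail = (\<lambda>a. case a of PlusA x y a' \<Rightarrow> PlusV x (tail (tgt c) a') | BaseA e \<Rightarrow> undefined),
     head = (\<lambda>a. case a of PlusA x y a' \<Rightarrow> PlusV y (head (tgt c) a') | BaseA e \<Rightarrow> undefined) \<rparr>"

definition plus_winding ::
    "('w, 'a, ('w, 'v) plus_vert, ('w, 'e) plus_arc) quiver_map \<Rightarrow> 'w \<Rightarrow>
     ('w, 'a, ('w, 'v) plus_vert, ('w, 'e) plus_arc) quiver_map" where
  "plus_winding c b =
     \<lparr> src = src c, tgt = plus_quiver c b, vmap = plus_vmap c b, amap = plus_amap c b \<rparr>"

definition base_quiver ::
    "('v, 'e) pre_digraph \<Rightarrow> (('w, 'v) plus_vert, ('w, 'e) plus_arc) pre_digraph" where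
  "base_quiver Q = \<lparr>
     verts = BaseV ` verts Q,
     arcs = BaseA ` arcs Q,
     tail = (\<lambda>a. case a of BaseA e \<Rightarrow> BaseV (tail Q e) | PlusA x y a' \<Rightarrow> undefined),
     head = (\<lambda>a. case a of BaseA e \<Rightarrow> BaseV (head Q e) | PlusA x y a' \<Rightarrow> undefined) \<rparr>"

definition base_winding ::
    "('w, 'a, 'v, 'e) quiver_map \<Rightarrow>
     ('w, 'a, ('w, 'v) plus_vert, ('w, 'e) plus_arc) quiver_map" where
  "base_winding c =
     \<lparr> src = src c, tgt = base_quiver (tgt c), vmap = BaseV \<circ> vmap c, amap = BaseA \<circ> amap c \<rparr>"

definition iterated_winding ::
    "('w, 'a, 'v, 'e) quiver_map \<Rightarrow> 'w \<Rightarrow> nat \<Rightarrow>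
     ('w, 'a, ('w, 'v) plus_vert, ('w, 'e) plus_arc) quiver_map" where
  "iterated_winding c b i = ((\<lambda>\<sigma>. plus_winding \<sigma> b) ^^ i) (base_winding c)"


section \<open>Affine maps\<close>

text \<open>
  Functions on the carrier of \<open>G\<close> are taken to be \<open>extensional\<close>, so that uniqueness of an affine
  map is not spoilt by arbitrary values off the carrier.
\<close>

definition affine_maps :: "('g, 'x) monoid_scheme \<Rightarrow> ('g \<Rightarrow> int) set" where
  "affine_maps G = {f \<in> extensional (carrier G). \<exists>z. (\<lambda>x. f x - z) \<in> hom G integer_group}"

end

theory Submission
  imports Defs
begin

text \<open>
  A nice grading \<open>d\<close> of a winding \<open>c : \<Gamma> \<rightarrow> Q\<close> assigns to every arrow of \<open>Q\<close> in the image of \<open>c\<close>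
  a well-defined increment, and hence extends to a homomorphism \<open>h : \<int>Q\<^sub>1 \<rightarrow> \<int>\<close>. On the image of a
  cycle of \<open>\<Gamma>\<close> the increments telescope to \<open>0\<close>, so \<open>h\<close> kills the image of \<open>H\<^sub>1(\<Gamma>)\<close>; it kills torsion
  because \<open>\<int>\<close> is torsion-free. Therefore \<open>h\<close> factors through the grading group, and since the value
  of the universal grading at \<open>v\<close> is the class of a walk from \<open>b\<close> to \<open>v\<close>, the factored map sends it
  to \<open>d v - d b\<close>. Adding the constant \<open>d b\<close> gives the affine map
  (\<open>nice_grading_factors\<close>). If every arrow of \<open>Q\<close> is hit by \<open>c\<close>, the class of each arrow is a difference
  of two values of the universal grading, and these classes generate the grading group; so the
  affine map is unique (\<open>affine_map_unique\<close>). After at least one step of the iteration every arrow is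
  hit, because the arrows of \<open>Q\<^sup>+\<close> are by construction images of arrows of \<open>\<Gamma>\<close>.

  It remains to see that the \<open>i\<close>-th member \<open>\<partial>\<^sub>i\<close> of a nice sequence is a nice grading of the \<open>i\<close>-th
  iterated winding, which is proved by strong induction on \<open>i\<close>. Two arrows with the same image under the
  \<open>i\<close>-th winding have the same image in \<open>Q\<close>, and their sources, as well as their targets, have
  equal universal gradings at all stages \<open>j < i\<close>. As \<open>\<partial>\<^sub>j\<close> already factors through the \<open>j\<close>-th universal
  grading, it agrees on these vertices too, so the condition defining niceness of \<open>\<partial>\<^sub>i\<close> relative to
  \<open>\<partial>\<^sub>0, \<dots>, \<partial>\<^bsub>i-1\<^esub>\<close> applies.

  Indecomposability of the representation enters through connectedness of its coefficient
  quiver: the elements in one connected component and those outside it span complementary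
  subrepresentations (\<open>coeff_quiver_connected\<close>).
\<close>

section \<open>Walks\<close>

lemma walk_append:
  "walk \<Gamma> u p v \<Longrightarrow> walk \<Gamma> v q w \<Longrightarrow> walk \<Gamma> u (p @ q) w"
  by (induction \<Gamma> u p v rule: walk.induct) (auto split: if_splits)

lemma walk_sum_append: "walk_sum c (p @ q) = walk_sum c p + walk_sum c q"
  by (simp add: walk_sum_def)

abbreviation boundary :: "('w, 'a) pre_digraph \<Rightarrow> ('a \<Rightarrow>\<^sub>0 int) \<Rightarrow> ('w \<Rightarrow>\<^sub>0 int)" where
  "boundary \<Gamma> \<equiv> frag_extend (\<lambda>\<alpha>. frag_of (head \<Gamma> \<alpha>) - frag_of (tail \<Gamma> \<alpha>))"

abbreviation pushforward :: "('w, 'a, 'v, 'e) quiver_map \<Rightarrow> ('a \<Rightarrow>\<^sub>0 int) \<Rightarrow> ('e \<Rightarrow>\<^sub>0 int)" where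
  "pushforward c \<equiv> frag_extend (\<lambda>\<alpha>. frag_of (amap c \<alpha>))"

text \<open>
  The signed sum of the arrows of a walk is a chain whose boundary telescopes. Lifting \<open>walk_sum\<close>
  to this chain makes walks accessible to the homological definition of the grading group.
\<close>

lemma walk_chain:
  assumes "walk (src c) u p v"
  obtains x where "x \<in> carrier (free_Abelian_group (arcs (src c)))"
    and "pushforward c x = walk_sum c p"
    and "boundary (src c) x = frag_of v - frag_of u"
proof -
  have "\<exists>x. x \<in> carrier (free_Abelian_group (arcs (src c))) \<and> pushforward c x = walk_sum c p \<and>
          boundary (src c) x = frag_of v - frag_of u"
    using assms
  proof (induction p arbitrary: u)
    case Nil
    then show ?case by (intro exI[of _ 0]) (simp add: walk_sum_def)
  next
    case (Cons s p)
    obtain \<alpha> fwd where s: "s = (\<alpha>, fwd)" by fastforce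
    let ?u' = "if fwd then head (src c) \<alpha> else tail (src c) \<alpha>"
    have "walk (src c) ?u' p v" and \<alpha>: "\<alpha> \<in> arcs (src c)"
      and u: "u = (if fwd then tail (src c) \<alpha> else head (src c) \<alpha>)"
      using Cons.prems by (auto simp: s split: if_splits)
    then obtain x where x: "x \<in> carrier (free_Abelian_group (arcs (src c)))"
      "pushforward c x = walk_sum c p" "boundary (src c) x = frag_of v - frag_of ?u'"
      using Cons.IH by blast
    let ?e = "if fwd then frag_of \<alpha> else - frag_of \<alpha>"
    have "Poly_Mapping.keys (?e + x) \<subseteq> arcs (src c)"
      using keys_add[of ?e x] x(1) \<alpha> by (auto split: if_splits)
    moreover have "pushforward c (?e + x) = walk_sum c (s # p)"
      using x(2) by (simp add: s frag_extend_add frag_extend_minus walk_sum_def)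
    moreover have "boundary (src c) (?e + x) = frag_of v - frag_of u"
      using x(3) by (simp add: u frag_extend_add frag_extend_minus)
    ultimately show ?case by (intro exI[of _ "?e + x"]) simp
  qed
  with that show thesis by blast
qed


section \<open>Torsion of a commutative group\<close>

lemma (in comm_group) subgroup_torsion_part: "subgroup (torsion_part G) G"
proof (rule subgroupI)
  show "torsion_part G \<subseteq> carrier G" by (auto simp: torsion_part_def)
  show "torsion_part G \<noteq> {}"
    unfolding torsion_part_def using nat_pow_one[of 1] zero_less_one one_closed by blast
next
  fix x assume "x \<in> torsion_part G"
  then show "inv x \<in> torsion_part G"
    unfolding torsion_part_def using nat_pow_inv[of x] by auto
next
  fix x y assume "x \<in> torsion_part G" "y \<in> torsion_part G"
  then obtain m n :: nat where *: "x \<in> carrier G" "y \<in> carrier G" "m > 0" "n > 0"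
    "x [^] m = \<one>" "y [^] n = \<one>"
    by (auto simp: torsion_part_def)
  have "x [^] (m * n) = \<one>" using * nat_pow_pow[of x m n] by simp
  moreover have "y [^] (m * n) = \<one>"
    using * nat_pow_pow[of y n m] by (simp add: mult.commute)
  ultimately have "(x \<otimes> y) [^] (m * n) = \<one>"
    using * by (simp add: nat_pow_distrib)
  moreover have "m * n > 0" using * by simp
  ultimately show "x \<otimes> y \<in> torsion_part G"
    using * by (auto simp: torsion_part_def intro!: exI[of _ "m * n"])
qed

lemma torsion_part_subset_kernel:
  assumes "group G" and h: "h \<in> hom G integer_group"
  shows "torsion_part G \<subseteq> kernel G integer_group h"
proof
  fix x assume "x \<in> torsion_part G"
  then obtain n :: nat where x: "x \<in> carrier G" "n > 0" "x [^]\<^bsub>G\<^esub> n = \<one>\<^bsub>G\<^esub>"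
    by (auto simp: torsion_part_def)
  interpret group_hom G integer_group h
    using assms by (simp add: group_hom_def group_hom_axioms_def)
  have "int n * h x = h (x [^]\<^bsub>G\<^esub> n)" using x(1) by (simp add: hom_nat_pow)
  also have "\<dots> = 0" using x(3) by simp
  finally show "x \<in> kernel G integer_group h" using x by (simp add: kernel_def)
qed


section \<open>The universal property of the universal grading\<close>

text \<open>
  Connectedness is what makes the universal grading meaningful at every vertex: its value at \<open>v\<close>
  comes from a walk from \<open>b\<close> to \<open>v\<close>. The conditions below pass from a map to its iterates, so the
  universal property is available at every stage of the iteration.
\<close>

locale connected_quiver_map =
  fixes c :: "('w, 'a, 'v, 'e) quiver_map" and b :: 'w
  assumes base_in: "b \<in> verts (src c)"
    and tail_in: "\<alpha> \<in> arcs (src c) \<Longrightarrow> tail (src c) \<alpha> \<in> verts (src c)"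
    and head_in: "\<alpha> \<in> arcs (src c) \<Longrightarrow> head (src c) \<alpha> \<in> verts (src c)"
    and amap_in: "\<alpha> \<in> arcs (src c) \<Longrightarrow> amap c \<alpha> \<in> arcs (tgt c)"
    and connected: "v \<in> verts (src c) \<Longrightarrow> \<exists>p. walk (src c) b p v"
begin

abbreviation arrow_chains :: "('e \<Rightarrow>\<^sub>0 int) monoid" where
  "arrow_chains \<equiv> free_Abelian_group (arcs (tgt c))"

lemma pushforward_in:
  "x \<in> carrier (free_Abelian_group (arcs (src c))) \<Longrightarrow> pushforward c x \<in> carrier arrow_chains"
  using keys_frag_extend[of "\<lambda>\<alpha>. frag_of (amap c \<alpha>)" x] amap_in by fastforce

lemma boundary_in:
  assumes "x \<in> carrier (free_Abelian_group (arcs (src c)))"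
  shows "boundary (src c) x \<in> carrier (free_Abelian_group (verts (src c)))"
  using assms keys_frag_extend[of "\<lambda>\<alpha>. frag_of (head (src c) \<alpha>) - frag_of (tail (src c) \<alpha>)" x]
    keys_diff[of "frag_of (head (src c) _)" "frag_of (tail (src c) _)"] head_in tail_in
  by (fastforce simp: subset_iff)

lemma subgroup_H1_image: "subgroup (H1_image c) arrow_chains"
proof -
  interpret f: group_hom "free_Abelian_group (arcs (src c))" arrow_chains "pushforward c"
    using pushforward_in
    by (auto simp: group_hom_def group_hom_axioms_def hom_def frag_extend_add)
  interpret g: group_hom "free_Abelian_group (arcs (src c))" "free_Abelian_group (verts (src c))"
      "boundary (src c)"
    using boundary_in
    by (auto simp: group_hom_def group_hom_axioms_def hom_def frag_extend_add)
  show ?thesis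
    unfolding H1_image_def H1_def
    by (rule f.subgroup_img_is_subgroup[OF g.subgroup_kernel])
qed

lemma normal_H1_image: "H1_image c \<lhd> arrow_chains"
  using abelian_free_Abelian_group comm_group.subgroup_imp_normal subgroup_H1_image by blast

lemma comm_group_homology_quot: "comm_group (homology_quot c)"
  unfolding homology_quot_def
  using abelian_free_Abelian_group comm_group.abelian_FactGroup subgroup_H1_image by blast

lemma normal_torsion_part: "torsion_part (homology_quot c) \<lhd> homology_quot c"
  using comm_group_homology_quot comm_group.subgroup_imp_normal comm_group.subgroup_torsion_part
  by blast

lemma group_grading_group: "group (grading_group c)"
  unfolding grading_group_def by (rule normal.factorgroup_is_group[OF normal_torsion_part])

lemma homology_class_hom:
  "(\<lambda>x. H1_image c #>\<^bsub>arrow_chains\<^esub> x) \<in> hom arrow_chains (homology_quot c)"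
  unfolding homology_quot_def by (rule normal.r_coset_hom_Mod[OF normal_H1_image])

lemma grading_class_hom: "grading_class c \<in> hom arrow_chains (grading_group c)"
proof -
  have "(\<lambda>x. torsion_part (homology_quot c) #>\<^bsub>homology_quot c\<^esub> x)
          \<in> hom (homology_quot c) (grading_group c)"
    unfolding grading_group_def by (rule normal.r_coset_hom_Mod[OF normal_torsion_part])
  from hom_compose[OF homology_class_hom this] show ?thesis
    by (simp add: comp_def grading_class_def[abs_def])
qed

lemma grading_class_surj:
  assumes "\<xi> \<in> carrier (grading_group c)"
  shows "\<exists>x \<in> carrier arrow_chains. \<xi> = grading_class c x"
proof -
  obtain Y where "Y \<in> carrier (homology_quot c)"
      "\<xi> = torsion_part (homology_quot c) #>\<^bsub>homology_quot c\<^esub> Y"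
    using assms by (auto simp: grading_group_def FactGroup_def RCOSETS_def)
  moreover from this obtain x where "x \<in> carrier arrow_chains" "Y = H1_image c #>\<^bsub>arrow_chains\<^esub> x"
    by (auto simp: homology_quot_def FactGroup_def RCOSETS_def)
  ultimately show ?thesis by (auto simp: grading_class_def)
qed

lemma grading_class_eqI:
  assumes "x - y \<in> H1_image c" "x \<in> carrier arrow_chains" "y \<in> carrier arrow_chains"
  shows "grading_class c x = grading_class c y"
proof -
  interpret N: normal "H1_image c" arrow_chains by (rule normal_H1_image)
  have "x = (x - y) \<otimes>\<^bsub>arrow_chains\<^esub> y" by simp
  then have "x \<in> H1_image c #>\<^bsub>arrow_chains\<^esub> y"
    using assms(1) unfolding r_coset_def by blast
  then have "H1_image c #>\<^bsub>arrow_chains\<^esub> y = H1_image c #>\<^bsub>arrow_chains\<^esub> x"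
    using N.repr_independence assms subgroup_H1_image by blast
  then show ?thesis by (simp add: grading_class_def)
qed

text \<open>
  Two walks with the same endpoints differ by a cycle, which represents zero in the grading group.
  The default value at the basepoint fits in because it is the class of the empty walk.
\<close>

lemma universal_grading_walk:
  assumes p: "walk (src c) b p v"
  shows "universal_grading c b v = grading_class c (walk_sum c p)"
    and "walk_sum c p \<in> carrier arrow_chains"
proof -
  have in_carrier: "walk_sum c q \<in> carrier arrow_chains" if "walk (src c) u q w" for q u w
    using walk_chain[OF that] pushforward_in by metis
  then show "walk_sum c p \<in> carrier arrow_chains" using p .
  have indep: "grading_class c (walk_sum c q) = grading_class c (walk_sum c p)"
    if q: "walk (src c) b q v" for q
  proof -
    obtain x where x: "x \<in> carrier (free_Abelian_group (arcs (src c)))"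
      "pushforward c x = walk_sum c q" "boundary (src c) x = frag_of v - frag_of b"
      by (rule walk_chain[OF q])
    obtain y where y: "y \<in> carrier (free_Abelian_group (arcs (src c)))"
      "pushforward c y = walk_sum c p" "boundary (src c) y = frag_of v - frag_of b"
      by (rule walk_chain[OF p])
    have "x - y \<in> H1 (src c)"
      using x y keys_diff[of x y] by (auto simp: H1_def kernel_def frag_extend_diff)
    then have "walk_sum c q - walk_sum c p \<in> H1_image c"
      using x(2) y(2) by (auto simp: H1_image_def frag_extend_diff intro!: image_eqI[of _ _ "x - y"])
    then show ?thesis using in_carrier p q by (intro grading_class_eqI)
  qed
  show "universal_grading c b v = grading_class c (walk_sum c p)"
  proof (cases "v = b")
    case True
    have "walk_sum c [] = \<one>\<^bsub>arrow_chains\<^esub>" by (simp add: walk_sum_def)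
    then have "grading_class c (walk_sum c []) = \<one>\<^bsub>grading_group c\<^esub>"
      using hom_one[OF grading_class_hom _ group_grading_group] by simp
    moreover have "walk (src c) b [] v" using True base_in by simp
    ultimately show ?thesis using indep True by (metis universal_grading_def)
  next
    case False
    have "(THE x. \<exists>q. walk (src c) b q v \<and> x = grading_class c (walk_sum c q)) =
            grading_class c (walk_sum c p)"
      using p indep by (intro the_equality) blast+
    then show ?thesis using False by (simp add: universal_grading_def)
  qed
qed

lemma universal_grading_in:
  "v \<in> verts (src c) \<Longrightarrow> universal_grading c b v \<in> carrier (grading_group c)"
  using connected[of v] universal_grading_walk grading_class_hom by (metis hom_in_carrier)

lemma universal_grading_arc:
  assumes "\<alpha> \<in> arcs (src c)"
  shows "universal_grading c b (head (src c) \<alpha>) =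
    universal_grading c b (tail (src c) \<alpha>) \<otimes>\<^bsub>grading_group c\<^esub> grading_class c (frag_of (amap c \<alpha>))"
proof -
  obtain p where p: "walk (src c) b p (tail (src c) \<alpha>)"
    using connected tail_in assms by blast
  moreover have "walk (src c) (tail (src c) \<alpha>) [(\<alpha>, True)] (head (src c) \<alpha>)"
    using assms head_in by simp
  ultimately have q: "walk (src c) b (p @ [(\<alpha>, True)]) (head (src c) \<alpha>)" by (rule walk_append)
  have "walk_sum c (p @ [(\<alpha>, True)]) = walk_sum c p \<otimes>\<^bsub>arrow_chains\<^esub> frag_of (amap c \<alpha>)"
    by (simp add: walk_sum_append) (simp add: walk_sum_def)
  moreover have "frag_of (amap c \<alpha>) \<in> carrier arrow_chains" using amap_in assms by simp
  ultimately show ?thesis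
    using universal_grading_walk[OF p] universal_grading_walk(1)[OF q] hom_mult[OF grading_class_hom]
    by presburger
qed

text \<open>
  The homomorphism \<open>h\<close> takes the increment of \<open>d\<close> on arrows in the image of \<open>c\<close>; on the other
  arrows any value will do. It is compared with the linear extension \<open>D\<close> of \<open>d\<close> to
  combinations of vertices.
\<close>

lemma nice_grading_factors:
  assumes d: "nice_grading c d"
  obtains ev where "ev \<in> affine_maps (grading_group c)"
    and "\<And>v. v \<in> verts (src c) \<Longrightarrow> d v = ev (universal_grading c b v)"
proof -
  let ?inc = "\<lambda>\<alpha>. d (head (src c) \<alpha>) - d (tail (src c) \<alpha>)"
  define \<phi> where "\<phi> e = ?inc (SOME \<alpha>. \<alpha> \<in> arcs (src c) \<and> amap c \<alpha> = e)" for e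
  have \<phi>: "\<phi> (amap c \<alpha>) = ?inc \<alpha>" if "\<alpha> \<in> arcs (src c)" for \<alpha>
  proof -
    define \<beta> where "\<beta> = (SOME \<beta>. \<beta> \<in> arcs (src c) \<and> amap c \<beta> = amap c \<alpha>)"
    have "\<beta> \<in> arcs (src c) \<and> amap c \<beta> = amap c \<alpha>"
      unfolding \<beta>_def by (rule someI[of _ \<alpha>]) (use that in simp)
    then have "?inc \<beta> = ?inc \<alpha>" using d that unfolding nice_grading_def by blast
    then show ?thesis by (simp add: \<phi>_def \<beta>_def)
  qed
  obtain h where h: "h \<in> hom arrow_chains integer_group"
    and h_of: "\<And>e. e \<in> arcs (tgt c) \<Longrightarrow> h (frag_of e) = \<phi> e"
    using comm_group.free_Abelian_group_universal[OF abelian_integer_group, of \<phi> "arcs (tgt c)"]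
    by auto
  obtain D where D: "D \<in> hom (free_Abelian_group (verts (src c))) integer_group"
    and D_of: "\<And>v. v \<in> verts (src c) \<Longrightarrow> D (frag_of v) = d v"
    using comm_group.free_Abelian_group_universal[OF abelian_integer_group, of d "verts (src c)"]
    by auto
  interpret h: group_hom arrow_chains integer_group h
    using h by (simp add: group_hom_def group_hom_axioms_def)
  interpret D: group_hom "free_Abelian_group (verts (src c))" integer_group D
    using D by (simp add: group_hom_def group_hom_axioms_def)
  have h_diff: "h (x - y) = h x - h y" if "x \<in> carrier arrow_chains" "y \<in> carrier arrow_chains" for x y
    using h.hom_mult[of x "inv\<^bsub>arrow_chains\<^esub> y"] h.hom_inv[of y] that by simp
  have D_diff: "D (x - y) = D x - D y" if "x \<in> carrier (free_Abelian_group (verts (src c)))"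
      "y \<in> carrier (free_Abelian_group (verts (src c)))" for x y
    using D.hom_mult[of x "inv\<^bsub>free_Abelian_group (verts (src c))\<^esub> y"] D.hom_inv[of y] that by simp
  have hD: "h (pushforward c x) = D (boundary (src c) x)"
    if "x \<in> carrier (free_Abelian_group (arcs (src c)))" for x
    using that[unfolded carrier_free_Abelian_group_iff]
  proof (induction rule: free_Abelian_group_induct[consumes 1, case_names zero diff arrow])
    case zero
    then show ?case using h.hom_one D.hom_one by simp
  next
    case (diff x y)
    then show ?case
      using h_diff[OF pushforward_in pushforward_in, of x y] D_diff[OF boundary_in boundary_in, of x y]
      by (simp add: frag_extend_diff)
  next
    case (arrow \<alpha>)
    then show ?case
      using \<phi> h_of amap_in D_diff[of "frag_of (head (src c) \<alpha>)" "frag_of (tail (src c) \<alpha>)"]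
        D_of head_in tail_in by simp
  qed
  have "H1_image c \<subseteq> kernel arrow_chains integer_group h"
  proof
    fix z assume "z \<in> H1_image c"
    then obtain x where "z = pushforward c x" "x \<in> carrier (free_Abelian_group (arcs (src c)))"
        "boundary (src c) x = 0"
      by (auto simp: H1_image_def H1_def kernel_def)
    then show "z \<in> kernel arrow_chains integer_group h"
      using hD[of x] pushforward_in[of x] D.hom_one by (simp add: kernel_def)
  qed
  then obtain g where g: "g \<in> hom (homology_quot c) integer_group"
    and g_of: "\<And>x. x \<in> carrier arrow_chains \<Longrightarrow> g (H1_image c #>\<^bsub>arrow_chains\<^esub> x) = h x"
    using h.FactGroup_universal_kernel[OF normal_H1_image] unfolding homology_quot_def by metis
  have "group (homology_quot c)" using comm_group_homology_quot comm_group.axioms(2) by blast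
  then interpret g: group_hom "homology_quot c" integer_group g
    using g by (simp add: group_hom_def group_hom_axioms_def)
  obtain f where f: "f \<in> hom (grading_group c) integer_group"
    and f_of: "\<And>x. x \<in> carrier (homology_quot c) \<Longrightarrow>
      f (torsion_part (homology_quot c) #>\<^bsub>homology_quot c\<^esub> x) = g x"
    using g.FactGroup_universal_kernel[OF normal_torsion_part]
      torsion_part_subset_kernel[OF \<open>group (homology_quot c)\<close> g]
    unfolding grading_group_def by metis
  have f_class: "f (grading_class c x) = h x" if "x \<in> carrier arrow_chains" for x
    using f_of[of "H1_image c #>\<^bsub>arrow_chains\<^esub> x"] g_of[OF that] hom_in_carrier[OF homology_class_hom that]
    by (simp add: grading_class_def)
  define ev where "ev = restrict (\<lambda>\<xi>. f \<xi> + d b) (carrier (grading_group c))"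
  have "(\<lambda>\<xi>. ev \<xi> - d b) \<in> hom (grading_group c) integer_group"
    using f group.is_monoid[OF group_grading_group]
    by (auto simp: hom_def ev_def monoid.m_closed)
  then have "ev \<in> affine_maps (grading_group c)"
    unfolding affine_maps_def ev_def by blast
  moreover have "d v = ev (universal_grading c b v)" if v: "v \<in> verts (src c)" for v
  proof -
    obtain p where p: "walk (src c) b p v" using connected v by blast
    obtain x where x: "x \<in> carrier (free_Abelian_group (arcs (src c)))"
      "pushforward c x = walk_sum c p" "boundary (src c) x = frag_of v - frag_of b"
      by (rule walk_chain[OF p])
    have "f (universal_grading c b v) = h (walk_sum c p)"
      using universal_grading_walk[OF p] f_class by simp
    also have "\<dots> = D (frag_of v - frag_of b)" using hD[OF x(1)] x(2,3) by simp
    also have "\<dots> = d v - d b"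
      using D_diff[of "frag_of v" "frag_of b"] D_of v base_in by simp
    finally show ?thesis using universal_grading_in[OF v] by (simp add: ev_def)
  qed
  ultimately show thesis using that by blast
qed

text \<open>
  An affine map agreeing with \<open>ev\<close> on the universal grading has the same constant term, read off
  at the basepoint, and the same value on the class of every arrow, which is the difference of the
  universal grading at its two ends; these classes generate.
\<close>

lemma affine_map_unique:
  assumes surj: "arcs (tgt c) \<subseteq> amap c ` arcs (src c)"
    and ev: "ev \<in> affine_maps (grading_group c)" and ev': "ev' \<in> affine_maps (grading_group c)"
    and eq: "\<And>v. v \<in> verts (src c) \<Longrightarrow> ev (universal_grading c b v) = ev' (universal_grading c b v)"
  shows "ev = ev'"
proof -
  let ?V = "grading_group c"
  have affine: "F (x \<otimes>\<^bsub>?V\<^esub> y) = F x + F y - F \<one>\<^bsub>?V\<^esub>"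
    if F: "F \<in> affine_maps ?V" and xy: "x \<in> carrier ?V" "y \<in> carrier ?V" for F x y
  proof -
    obtain z where z: "(\<lambda>x. F x - z) \<in> hom ?V integer_group"
      using F by (auto simp: affine_maps_def)
    have "F \<one>\<^bsub>?V\<^esub> - z = 0" using hom_one[OF z group_grading_group] by simp
    then show ?thesis using hom_mult[OF z xy] by simp
  qed
  have at_one: "ev \<one>\<^bsub>?V\<^esub> = ev' \<one>\<^bsub>?V\<^esub>"
    using eq[OF base_in] by (simp add: universal_grading_def)
  have "ev (grading_class c x) = ev' (grading_class c x)" if "x \<in> carrier arrow_chains" for x
    using that[unfolded carrier_free_Abelian_group_iff]
  proof (induction rule: free_Abelian_group_induct[consumes 1, case_names zero diff arrow])
    case zero
    have "grading_class c 0 = \<one>\<^bsub>?V\<^esub>"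
      using hom_one[OF grading_class_hom _ group_grading_group] by simp
    then show ?case using at_one by simp
  next
    case (diff x y)
    have xy: "x - y \<in> carrier arrow_chains" "y \<in> carrier arrow_chains"
      using diff keys_diff[of x y] by auto
    have x: "grading_class c x = grading_class c (x - y) \<otimes>\<^bsub>?V\<^esub> grading_class c y"
      using hom_mult[OF grading_class_hom xy] by simp
    have F: "F (grading_class c (x - y)) =
        F (grading_class c x) - F (grading_class c y) + F \<one>\<^bsub>?V\<^esub>" if "F \<in> affine_maps ?V" for F
      using affine[OF that, of "grading_class c (x - y)" "grading_class c y"] x
        hom_in_carrier[OF grading_class_hom] xy by simp
    show ?case using F[OF ev] F[OF ev'] diff at_one by linarith
  next
    case (arrow e)
    from arrow obtain \<alpha> where \<alpha>: "\<alpha> \<in> arcs (src c)" "e = amap c \<alpha>" using surj by blast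
    have e: "grading_class c (frag_of e) \<in> carrier ?V"
      using hom_in_carrier[OF grading_class_hom, of "frag_of e"] arrow by simp
    have F: "F (grading_class c (frag_of e)) = F (universal_grading c b (head (src c) \<alpha>))
        - F (universal_grading c b (tail (src c) \<alpha>)) + F \<one>\<^bsub>?V\<^esub>" if "F \<in> affine_maps ?V" for F
      using affine[OF that universal_grading_in e] universal_grading_arc \<alpha> tail_in by simp
    show ?case
      using F[OF ev] F[OF ev'] at_one eq[OF head_in[OF \<alpha>(1)]] eq[OF tail_in[OF \<alpha>(1)]] by linarith
  qed
  then have "ev \<xi> = ev' \<xi>" if "\<xi> \<in> carrier ?V" for \<xi>
    using grading_class_surj[OF that] by metis
  moreover have "ev \<in> extensional (carrier ?V)" "ev' \<in> extensional (carrier ?V)"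
    using ev ev' by (auto simp: affine_maps_def)
  ultimately show ?thesis by (intro extensionalityI)
qed

end


section \<open>The coefficient quiver of an indecomposable representation\<close>

lemma walk_forward:
  "walk \<Gamma> b p (tail \<Gamma> \<alpha>) \<Longrightarrow> \<alpha> \<in> arcs \<Gamma> \<Longrightarrow> head \<Gamma> \<alpha> \<in> verts \<Gamma> \<Longrightarrow> \<exists>q. walk \<Gamma> b q (head \<Gamma> \<alpha>)"
  using walk_append[of \<Gamma> b p "tail \<Gamma> \<alpha>" "[(\<alpha>, True)]"] by auto

lemma walk_backward:
  "walk \<Gamma> b p (head \<Gamma> \<alpha>) \<Longrightarrow> \<alpha> \<in> arcs \<Gamma> \<Longrightarrow> tail \<Gamma> \<alpha> \<in> verts \<Gamma> \<Longrightarrow> \<exists>q. walk \<Gamma> b q (tail \<Gamma> \<alpha>)"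
  using walk_append[of \<Gamma> b p "head \<Gamma> \<alpha>" "[(\<alpha>, False)]"] by auto

text \<open>
  The elements reachable from \<open>b\<close> and the unreachable ones are both closed under the action, since
  an arrow never joins one kind to the other; so they decompose the representation. The first
  summand contains \<open>b\<close>, hence the second is zero.
\<close>

lemma coeff_quiver_connected:
  fixes Q :: "('v, 'e) pre_digraph" and M :: "('v, 'e, 'm) f1_rep"
  defines "\<Gamma> \<equiv> coeff_quiver Q M"
  assumes Q: "wf_digraph Q" and M: "f1_representation Q M" and ind: "indecomposable Q M"
    and b: "b \<in> verts \<Gamma>" and v: "v \<in> verts \<Gamma>"
  shows "\<exists>p. walk \<Gamma> b p v"
proof (rule ccontr)
  assume not_v: "\<nexists>p. walk \<Gamma> b p v"
  define R where "R u x \<longleftrightarrow> (\<exists>p. walk \<Gamma> b p (u, x))" for u x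
  define N where "N u = {x \<in> pts M u. x = base M u \<or> R u x}" for u
  define N' where "N' u = {x \<in> pts M u. x = base M u \<or> \<not> R u x}" for u
  have act_in: "act M \<alpha> x \<in> pts M (head Q \<alpha>)" if "\<alpha> \<in> arcs Q" "x \<in> pts M (tail Q \<alpha>)" for \<alpha> x
    using M that by (auto simp: f1_representation_def f1_linear_def)
  have act_base: "act M \<alpha> (base M (tail Q \<alpha>)) = base M (head Q \<alpha>)" if "\<alpha> \<in> arcs Q" for \<alpha>
    using M that by (auto simp: f1_representation_def f1_linear_def)
  have base_pts: "base M u \<in> pts M u" if "u \<in> verts Q" for u
    using M that by (auto simp: f1_representation_def f1_space_def)
  have R_act: "R (head Q \<alpha>) (act M \<alpha> x) \<longleftrightarrow> R (tail Q \<alpha>) x"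
    if "\<alpha> \<in> arcs Q" "x \<in> pts M (tail Q \<alpha>)" "act M \<alpha> x \<noteq> base M (head Q \<alpha>)" for \<alpha> x
  proof -
    have x: "x \<noteq> base M (tail Q \<alpha>)" using act_base that by metis
    have arc: "(\<alpha>, x) \<in> arcs \<Gamma>" using that x by (simp add: \<Gamma>_def coeff_quiver_def)
    have t: "tail \<Gamma> (\<alpha>, x) = (tail Q \<alpha>, x)" and h: "head \<Gamma> (\<alpha>, x) = (head Q \<alpha>, act M \<alpha> x)"
      by (simp_all add: \<Gamma>_def coeff_quiver_def)
    have "(tail Q \<alpha>, x) \<in> verts \<Gamma>" "(head Q \<alpha>, act M \<alpha> x) \<in> verts \<Gamma>"
      using that x act_in wf_digraph.tail_in_verts[OF Q] wf_digraph.head_in_verts[OF Q]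
      by (simp_all add: \<Gamma>_def coeff_quiver_def)
    then show ?thesis
      using walk_forward[of \<Gamma> b _ "(\<alpha>, x)"] walk_backward[of \<Gamma> b _ "(\<alpha>, x)"] arc
      unfolding R_def t h by blast
  qed
  have "subrep Q M N"
    using act_in act_base base_pts R_act unfolding subrep_def N_def by fastforce
  moreover have "subrep Q M N'"
    using act_in act_base base_pts R_act unfolding subrep_def N'_def by fastforce
  moreover have "internal_sum Q M N N'"
    using base_pts unfolding internal_sum_def N_def N'_def by blast
  moreover have "nonzero_subrep Q M N"
  proof -
    have "walk \<Gamma> b [] b" using b by simp
    then have "R (fst b) (snd b)" unfolding R_def by (metis prod.collapse)
    then have "fst b \<in> verts Q" "snd b \<in> N (fst b)" "snd b \<noteq> base M (fst b)"
      using b by (auto simp: \<Gamma>_def coeff_quiver_def N_def)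
    then show ?thesis unfolding nonzero_subrep_def by blast
  qed
  moreover have "nonzero_subrep Q M N'"
  proof -
    have "\<not> R (fst v) (snd v)" using not_v by (simp add: R_def)
    then have "fst v \<in> verts Q" "snd v \<in> N' (fst v)" "snd v \<noteq> base M (fst v)"
      using v by (auto simp: \<Gamma>_def coeff_quiver_def N'_def)
    then show ?thesis unfolding nonzero_subrep_def by blast
  qed
  ultimately show False using ind unfolding indecomposable_def by blast
qed

lemma connected_assoc_winding:
  assumes Q: "wf_digraph Q" and M: "f1_representation Q M" and ind: "indecomposable Q M"
    and b: "b \<in> verts (src (assoc_winding Q M))"
  shows "connected_quiver_map (assoc_winding Q M) b"
proof
  show "b \<in> verts (src (assoc_winding Q M))" by (rule b)
  show "\<exists>p. walk (src (assoc_winding Q M)) b p v" if "v \<in> verts (src (assoc_winding Q M))" for v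
    using coeff_quiver_connected[OF Q M ind] b that by (simp add: assoc_winding_def)
  fix \<alpha> assume \<alpha>: "\<alpha> \<in> arcs (src (assoc_winding Q M))"
  then have "act M (fst \<alpha>) (snd \<alpha>) \<in> pts M (head Q (fst \<alpha>))"
    using M by (fastforce simp: assoc_winding_def coeff_quiver_def f1_representation_def f1_linear_def)
  then show "tail (src (assoc_winding Q M)) \<alpha> \<in> verts (src (assoc_winding Q M))"
    "head (src (assoc_winding Q M)) \<alpha> \<in> verts (src (assoc_winding Q M))"
    "amap (assoc_winding Q M) \<alpha> \<in> arcs (tgt (assoc_winding Q M))"
    using \<alpha> wf_digraph.tail_in_verts[OF Q] wf_digraph.head_in_verts[OF Q]
    by (auto simp: assoc_winding_def coeff_quiver_def)
qed


section \<open>Iterated windings and nice sequences\<close>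

lemma iterated_winding_simps:
  "iterated_winding c b 0 = base_winding c"
  "iterated_winding c b (Suc i) = plus_winding (iterated_winding c b i) b"
  by (simp_all add: iterated_winding_def)

lemma src_iterated_winding [simp]: "src (iterated_winding c b i) = src c"
  by (induction i) (simp_all add: iterated_winding_simps base_winding_def plus_winding_def)

lemma arcs_tgt_iterated_winding:
  assumes "0 < i \<or> amap c ` arcs (src c) = arcs (tgt c)"
  shows "arcs (tgt (iterated_winding c b i)) = amap (iterated_winding c b i) ` arcs (src c)"
  using assms
  by (cases i)
    (auto simp: iterated_winding_simps base_winding_def base_quiver_def plus_winding_def
      plus_quiver_def)

text \<open>
  Unfolding an arrow of the \<open>i\<close>-th quiver step by step exposes its arrow of \<open>Q\<close> and the fibres at all
  earlier stages. A vertex lies in its own fibre, so equal fibres force equal gradings; for this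
  the ends of \<open>\<beta>\<close> have to be vertices.
\<close>

lemma amap_iterated_winding_eqD:
  assumes "amap (iterated_winding c b i) \<beta> = amap (iterated_winding c b i) \<beta>'"
    and "head (src c) \<beta> \<in> verts (src c)" "tail (src c) \<beta> \<in> verts (src c)"
  shows "amap c \<beta> = amap c \<beta>'"
    and "j < i \<Longrightarrow> universal_grading (iterated_winding c b j) b (tail (src c) \<beta>) =
      universal_grading (iterated_winding c b j) b (tail (src c) \<beta>')"
    and "j < i \<Longrightarrow> universal_grading (iterated_winding c b j) b (head (src c) \<beta>) =
      universal_grading (iterated_winding c b j) b (head (src c) \<beta>')"
proof -
  have "amap c \<beta> = amap c \<beta>' \<and> (\<forall>j<i.
      universal_grading (iterated_winding c b j) b (tail (src c) \<beta>) =
      universal_grading (iterated_winding c b j) b (tail (src c) \<beta>') \<and>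
      universal_grading (iterated_winding c b j) b (head (src c) \<beta>) =
      universal_grading (iterated_winding c b j) b (head (src c) \<beta>'))"
    using assms(1)
  proof (induction i)
    case 0
    then show ?case by (simp add: iterated_winding_simps base_winding_def)
  next
    case (Suc i)
    let ?\<sigma> = "iterated_winding c b i"
    have "amap ?\<sigma> \<beta> = amap ?\<sigma> \<beta>'"
      and "grading_fibre ?\<sigma> b (tail (src c) \<beta>) = grading_fibre ?\<sigma> b (tail (src c) \<beta>')"
      and "grading_fibre ?\<sigma> b (head (src c) \<beta>) = grading_fibre ?\<sigma> b (head (src c) \<beta>')"
      using Suc.prems by (simp_all add: iterated_winding_simps plus_winding_def plus_amap_def)
    moreover from this(2,3)
    have "universal_grading ?\<sigma> b (tail (src c) \<beta>) = universal_grading ?\<sigma> b (tail (src c) \<beta>')"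
      "universal_grading ?\<sigma> b (head (src c) \<beta>) = universal_grading ?\<sigma> b (head (src c) \<beta>')"
      using assms(2,3) by (auto simp: grading_fibre_def)
    ultimately show ?case using Suc.IH by (auto simp: less_Suc_eq)
  qed
  then show "amap c \<beta> = amap c \<beta>'"
    and "j < i \<Longrightarrow> universal_grading (iterated_winding c b j) b (tail (src c) \<beta>) =
      universal_grading (iterated_winding c b j) b (tail (src c) \<beta>')"
    and "j < i \<Longrightarrow> universal_grading (iterated_winding c b j) b (head (src c) \<beta>) =
      universal_grading (iterated_winding c b j) b (head (src c) \<beta>')"
    by blast+
qed

context connected_quiver_map
begin

lemma connected_iterated_winding: "connected_quiver_map (iterated_winding c b i) b"
proof
  fix \<alpha> assume "\<alpha> \<in> arcs (src (iterated_winding c b i))"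
  then have "\<alpha> \<in> arcs (src c)" by simp
  then show "amap (iterated_winding c b i) \<alpha> \<in> arcs (tgt (iterated_winding c b i))"
    using arcs_tgt_iterated_winding[of i c b] amap_in
    by (cases i) (auto simp: iterated_winding_simps base_winding_def base_quiver_def)
qed (simp_all add: base_in tail_in head_in connected)

text \<open>
  Niceness of \<open>\<partial>\<^sub>i\<close> is required on pairs of arrows on whose ends the earlier \<open>\<partial>\<^sub>j\<close> agree. Arrows
  identified at stage \<open>i\<close> form such pairs, since by induction \<open>\<partial>\<^sub>j\<close> is a function of the \<open>j\<close>-th
  universal grading.
\<close>

theorem nice_sequence_nice_grading:
  assumes ds: "nice_sequence c ds"
  shows "nice_grading (iterated_winding c b i) (ds i)"
proof (induction i rule: less_induct)
  case (less i)
  have factors: "ds j u = ds j w"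
    if j: "j < i" and uw: "u \<in> verts (src c)" "w \<in> verts (src c)"
      "universal_grading (iterated_winding c b j) b u = universal_grading (iterated_winding c b j) b w"
    for j u w
  proof -
    interpret \<sigma>: connected_quiver_map "iterated_winding c b j" b
      by (rule connected_iterated_winding)
    obtain ev where "\<And>v. v \<in> verts (src c) \<Longrightarrow> ds j v = ev (universal_grading (iterated_winding c b j) b v)"
      using \<sigma>.nice_grading_factors[OF less.IH[OF j]] by auto
    then show ?thesis using uw by simp
  qed
  have nice: "nice_grading_wrt c ds i (ds i)"
  proof (cases "i = 0")
    case True
    then have "nice_grading c (ds i)" using ds by (simp add: nice_sequence_def)
    then show ?thesis unfolding nice_grading_def nice_grading_wrt_def by blast
  next
    case False
    then show ?thesis using ds by (simp add: nice_sequence_def)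
  qed
  show ?case
    unfolding nice_grading_def
  proof (intro ballI impI)
    fix \<beta> \<beta>'
    assume \<beta>: "\<beta> \<in> arcs (src (iterated_winding c b i))" "\<beta>' \<in> arcs (src (iterated_winding c b i))"
      and eq: "amap (iterated_winding c b i) \<beta> = amap (iterated_winding c b i) \<beta>'"
    have arcs: "\<beta> \<in> arcs (src c)" "\<beta>' \<in> arcs (src c)" using \<beta> by simp_all
    note same = amap_iterated_winding_eqD[OF eq head_in[OF arcs(1)] tail_in[OF arcs(1)]]
    have "ds j (tail (src c) \<beta>) = ds j (tail (src c) \<beta>')"
      "ds j (head (src c) \<beta>) = ds j (head (src c) \<beta>')" if "j < i" for j
      using factors[OF that tail_in[OF arcs(1)] tail_in[OF arcs(2)] same(2)[OF that]]
        factors[OF that head_in[OF arcs(1)] head_in[OF arcs(2)] same(3)[OF that]] by blast+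
    then show "ds i (head (src (iterated_winding c b i)) \<beta>) - ds i (tail (src (iterated_winding c b i)) \<beta>) =
      ds i (head (src (iterated_winding c b i)) \<beta>') - ds i (tail (src (iterated_winding c b i)) \<beta>')"
      using nice arcs same(1) unfolding nice_grading_wrt_def src_iterated_winding by blast
  qed
qed

end

theorem theorem4p19:
  fixes Q :: "('v, 'e) pre_digraph"
    and M :: "('v, 'e, 'm) f1_rep"
    and b :: "'v \<times> 'm"
    and ds :: "nat \<Rightarrow> 'v \<times> 'm \<Rightarrow> int"
    and i :: nat
  defines "c \<equiv> assoc_winding Q M"
  defines "\<sigma> \<equiv> iterated_winding c b i"
  assumes "fin_digraph Q"
    and "f1_representation Q M"
    and "indecomposable Q M"
    and "b \<in> verts (src c)"
    and "nice_sequence c ds"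
  shows "(\<exists>ev \<in> affine_maps (grading_group \<sigma>).
            \<forall>v \<in> verts (src c). ds i v = ev (universal_grading \<sigma> b v)) \<and>
         (0 < i \<or> amap c ` arcs (src c) = arcs (tgt c) \<longrightarrow>
          (\<exists>!ev. ev \<in> affine_maps (grading_group \<sigma>) \<and>
            (\<forall>v \<in> verts (src c). ds i v = ev (universal_grading \<sigma> b v))))"
proof -
  interpret c: connected_quiver_map c b
    unfolding c_def
    by (rule connected_assoc_winding[OF fin_digraph.axioms(1)]) (use assms in \<open>simp_all add: c_def\<close>)
  interpret \<sigma>: connected_quiver_map \<sigma> b
    unfolding \<sigma>_def by (rule c.connected_iterated_winding)
  have src: "src \<sigma> = src c" by (simp add: \<sigma>_def)
  have "nice_grading \<sigma> (ds i)"
    unfolding \<sigma>_def by (rule c.nice_sequence_nice_grading) (rule assms)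
  then obtain ev where ev: "ev \<in> affine_maps (grading_group \<sigma>)"
    and factors: "\<forall>v \<in> verts (src c). ds i v = ev (universal_grading \<sigma> b v)"
    using \<sigma>.nice_grading_factors src by metis
  have "ev' = ev"
    if "0 < i \<or> amap c ` arcs (src c) = arcs (tgt c)" and "ev' \<in> affine_maps (grading_group \<sigma>)"
      "\<forall>v \<in> verts (src c). ds i v = ev' (universal_grading \<sigma> b v)" for ev'
  proof (rule \<sigma>.affine_map_unique)
    show "arcs (tgt \<sigma>) \<subseteq> amap \<sigma> ` arcs (src \<sigma>)"
      using arcs_tgt_iterated_winding[OF that(1), of b] by (simp add: \<sigma>_def)
  qed (use that ev factors src in simp_all)
  with ev factors show ?thesis by (intro conjI impI ex1I[of _ ev]) blast+
qed

end
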